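(* Let $n\ge2$, let $a\in L^n(\mathbb{H}^n)$ be a $1$-form with $d^*a=0$, and let $u$ be the Navier–Stokes mild solution with initial datum $a$ and time of existence $T>0$ described in the context. Then $$u\in L^r\big((0,T),L^q(\mathbb{H}^n)\big)$$ whenever $1\le r<\infty$ and $n<q<\infty$ satisfy $$\frac12-\frac{n}{2q}<\frac1r.$$ Moreover, if $\|a\|_{L^n(\mathbb{H}^n)}\le\lambda$, where $\lambda>0$ is the smallness constant for global existence described in the context, then this holds with $T=+\infty$.
   Context: $\mathbb{H}^n$ is the $n$-dimensional hyperbolic space of constant sectional curvature $-1$ with metric $g$. $L^q(\mathbb{H}^n)$ denotes the $L^q$ space for functions, forms and tensors alike. $BC(I,X)$ is the space of bounded continuous functions from $I$ to $X$. $\nabla$ is the Levi-Civita connection, $d$ the exterior derivative, $d^*$ its formal adjoint, $\#$ and $\flat$ the musical isomorphisms; $\Delta_g f=\mathrm{div}(\mathrm{grad} f)$, $\Delta_{B,1}=-\nabla^*\nabla$ on $1$-forms, $\Delta_{H,1}=d^*d+dd^*$. $\mathbb{P}=I-d(-\Delta_g)^{-1}d^*$ on $1$-forms. $L=-2\,\mathrm{Def}^*\mathrm{Def}=-\Delta_{H,1}-dd^*+2\mathrm{Ric}$, where $\mathrm{Def}\,u=\frac12(\nabla u+(\nabla u)^T)$ and, on $\mathbb{H}^n$, $\mathrm{Ric}=-(n-1)I$; when $d^*u=0$ one has $Lu=\Delta_{B,1}u-(n-1)u$. $e^{tL}$ is the semigroup generated by $L$ on $L^p$ $1$-forms. A mild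 solution on $[0,T)$ with datum $a$, $d^*a=0$, is a time-dependent $1$-form $u$ with $$u(t)=e^{tL}a-\int_0^t e^{(t-s)L}\,\mathbb{P}\big((\mathrm{div}(u^{\#}\otimes u^{\#}))^{\flat}\big)(s)\,ds,\qquad 0\le t<T.$$ The solution $u$ with time of existence $T>0$ is the unique mild solution on $[0,T)$ such that for every $n\le q<\infty$ there are $\beta,\beta''>0$ with $t^{\frac12-\frac{n}{2q}}e^{t\beta}u\in BC([0,T),L^q(\mathbb{H}^n))$ and $t^{1-\frac{n}{2q}}e^{t\beta''}\nabla u\in BC([0,T),L^q(\mathbb{H}^n))$, both with value zero at $t=0$, except for $q=n$ in the first, in which case $u(0)=a$. The constant $\lambda>0$ is one for which $\|a\|_{L^n(\mathbb{H}^n)}\le\lambda$ guarantees that this solution is global, i.e. $u$ is a mild solution on $[0,\infty)$ with datum $a$ and for every $n\le q<\infty$ there are $\beta,\beta''>0$ with $t^{\frac12-\frac{n}{2q}}e^{t\beta}u\in BC([0,\infty),L^q(\mathbb{H}^n))$ and $t^{1-\frac{n}{2q}}e^{t\beta''}\nabla u\in BC([0,\infty),L^q(\mathbb{H}^n))$, both with value zero at $t=0$, except for $q=n$ in the first, in which case $u(0)=a$. *)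

theory Defs
  imports "HOL-Analysis.Analysis"
begin

text \<open>
  Hyperbolic space of dimension n = CARD('n) is the Poincare ball: the open unit ball with
  metric \<open>g\<^sub>i\<^sub>j = 4 / (1 - |x|^2)^2 \<delta>\<^sub>i\<^sub>j\<close>. This is one global chart, so tensor fields are given by
  their coordinate components; values outside the ball are irrelevant. Everything below is
  expressed through \<open>g\<close>, its inverse and its Christoffel symbols.
\<close>

type_synonym 'n scalar_field = "real ^ 'n \<Rightarrow> real"
type_synonym 'n one_form = "real ^ 'n \<Rightarrow> real ^ 'n"
type_synonym 'n vec_field = "real ^ 'n \<Rightarrow> real ^ 'n"
type_synonym 'n two_tensor = "real ^ 'n \<Rightarrow> real ^ 'n ^ 'n"

abbreviation hspace :: "(real ^ 'n::finite) set"
  where "hspace \<equiv> ball 0 1"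

definition gmat :: "real ^ 'n::finite \<Rightarrow> real ^ 'n ^ 'n"
  where "gmat x = mat (4 / (1 - (norm x)\<^sup>2)\<^sup>2)"

definition ginv :: "real ^ 'n::finite \<Rightarrow> real ^ 'n ^ 'n"
  where "ginv x = matrix_inv (gmat x)"

definition hvol :: "(real ^ 'n::finite) measure"
  where "hvol = density (restrict_space lborel hspace) (\<lambda>x. ennreal (sqrt (det (gmat x))))"

definition sharp :: "'n::finite one_form \<Rightarrow> 'n vec_field"
  where "sharp u x = ginv x *v u x"

definition flat :: "'n::finite vec_field \<Rightarrow> 'n one_form"
  where "flat X x = gmat x *v X x"


subsection \<open>Pointwise inner products and norms of covariant tensors\<close>

definition form_inner :: "real ^ 'n::finite \<Rightarrow> real ^ 'n \<Rightarrow> real ^ 'n \<Rightarrow> real"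
  where "form_inner x u v = (\<Sum>i\<in>UNIV. \<Sum>j\<in>UNIV. ginv x $ i $ j * u $ i * v $ j)"

definition tensor_inner :: "real ^ 'n::finite \<Rightarrow> real ^ 'n ^ 'n \<Rightarrow> real ^ 'n ^ 'n \<Rightarrow> real"
  where "tensor_inner x S T = (\<Sum>i\<in>UNIV. \<Sum>j\<in>UNIV. \<Sum>k\<in>UNIV. \<Sum>l\<in>UNIV.
           ginv x $ i $ k * ginv x $ j $ l * S $ i $ j * T $ k $ l)"

definition scalar_norm :: "real ^ 'n::finite \<Rightarrow> real \<Rightarrow> real"
  where "scalar_norm x c = \<bar>c\<bar>"

definition form_norm :: "real ^ 'n::finite \<Rightarrow> real ^ 'n \<Rightarrow> real"
  where "form_norm x u = sqrt (form_inner x u u)"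

definition tensor_norm :: "real ^ 'n::finite \<Rightarrow> real ^ 'n ^ 'n \<Rightarrow> real"
  where "tensor_norm x T = sqrt (tensor_inner x T T)"


subsection \<open>Differential operators on smooth fields\<close>

definition pd :: "'n::finite \<Rightarrow> 'n scalar_field \<Rightarrow> 'n scalar_field"
  where "pd i f x = frechet_derivative f (at x) (axis i 1)"

definition christoffel :: "real ^ 'n::finite \<Rightarrow> 'n \<Rightarrow> 'n \<Rightarrow> 'n \<Rightarrow> real"
  \<comment> \<open>\<open>christoffel x k i j\<close> is the symbol with upper index \<open>k\<close> and lower indices \<open>i j\<close>.\<close>
  where "christoffel x k i j = (1 / 2) * (\<Sum>l\<in>UNIV. ginv x $ k $ l *
           (pd i (\<lambda>y. gmat y $ j $ l) x + pd j (\<lambda>y. gmat y $ i $ l) x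
              - pd l (\<lambda>y. gmat y $ i $ j) x))"

definition ext_d :: "'n::finite scalar_field \<Rightarrow> 'n one_form"
  where "ext_d f x = (\<chi> i. pd i f x)"

definition hdiv :: "'n::finite vec_field \<Rightarrow> 'n scalar_field"
  where "hdiv X x = (\<Sum>i\<in>UNIV. pd i (\<lambda>y. X y $ i) x)
           + (\<Sum>i\<in>UNIV. \<Sum>k\<in>UNIV. christoffel x i i k * X x $ k)"

definition hgrad :: "'n::finite scalar_field \<Rightarrow> 'n vec_field"
  where "hgrad f = sharp (ext_d f)"

definition hlap :: "'n::finite scalar_field \<Rightarrow> 'n scalar_field"
  where "hlap f = hdiv (hgrad f)"

definition codiff :: "'n::finite one_form \<Rightarrow> 'n scalar_field"
  where "codiff u x = - hdiv (sharp u) x"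

definition nabla :: "'n::finite one_form \<Rightarrow> 'n two_tensor"
  \<comment> \<open>\<open>nabla u x $ i $ j\<close> is the \<open>j\<close> component of the derivative of \<open>u\<close> in direction \<open>i\<close>.\<close>
  where "nabla u x = (\<chi> i j. pd i (\<lambda>y. u y $ j) x - (\<Sum>k\<in>UNIV. christoffel x k i j * u x $ k))"

definition nabla_tensor :: "'n::finite two_tensor \<Rightarrow> real ^ 'n \<Rightarrow> 'n \<Rightarrow> 'n \<Rightarrow> 'n \<Rightarrow> real"
  where "nabla_tensor T x k i j = pd k (\<lambda>y. T y $ i $ j) x
           - (\<Sum>l\<in>UNIV. christoffel x l k i * T x $ l $ j)
           - (\<Sum>l\<in>UNIV. christoffel x l k j * T x $ i $ l)"

definition nabla_adj :: "'n::finite two_tensor \<Rightarrow> 'n one_form"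
  \<comment> \<open>The formal adjoint of \<open>nabla\<close>: minus the trace of the derivative over the derivative index
     and the first index.\<close>
  where "nabla_adj T x = (\<chi> j. - (\<Sum>k\<in>UNIV. \<Sum>i\<in>UNIV. ginv x $ k $ i * nabla_tensor T x k i j))"

definition Def_op :: "'n::finite one_form \<Rightarrow> 'n two_tensor"
  where "Def_op u x = (1 / 2) *\<^sub>R (nabla u x + transpose (nabla u x))"

definition Def_adj :: "'n::finite two_tensor \<Rightarrow> 'n one_form"
  \<comment> \<open>The formal adjoint of \<open>Def_op\<close>, written for arbitrary (not only symmetric) 2-tensors.\<close>
  where "Def_adj T = nabla_adj (\<lambda>x. (1 / 2) *\<^sub>R (T x + transpose (T x)))"

definition L_op :: "'n::finite one_form \<Rightarrow> 'n one_form"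
  where "L_op u x = (- 2) *\<^sub>R Def_adj (Def_op u) x"


subsection \<open>Compactly supported smooth fields and weak derivatives\<close>

definition test_fun :: "'n::finite scalar_field \<Rightarrow> bool"
  \<comment> \<open>All iterated partial derivatives exist and are differentiable, i.e. the function is smooth;
     the support is a compact subset of the ball.\<close>
  where "test_fun f \<longleftrightarrow> (\<forall>is x. fold pd is f differentiable (at x)) \<and>
           (\<exists>K. compact K \<and> K \<subseteq> hspace \<and> (\<forall>x. x \<notin> K \<longrightarrow> f x = 0))"

definition test_form :: "'n::finite one_form \<Rightarrow> bool"
  where "test_form u \<longleftrightarrow> (\<forall>i. test_fun (\<lambda>x. u x $ i))"

definition test_tensor :: "'n::finite two_tensor \<Rightarrow> bool"
  where "test_tensor T \<longleftrightarrow> (\<forall>i j. test_fun (\<lambda>x. T x $ i $ j))"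

definition L1loc :: "(real ^ 'n::finite \<Rightarrow> 'b::{banach, second_countable_topology}) \<Rightarrow> bool"
  \<comment> \<open>On compact subsets of the ball the metric is comparable to the Euclidean one, so it plays no
     role here.\<close>
  where "L1loc u \<longleftrightarrow> (\<forall>K. compact K \<and> K \<subseteq> hspace \<longrightarrow> set_integrable lborel K u)"

definition weak_ext_d :: "'n::finite scalar_field \<Rightarrow> 'n one_form \<Rightarrow> bool"
  where "weak_ext_d f v \<longleftrightarrow> L1loc f \<and> L1loc v \<and>
           (\<forall>\<phi>. test_form \<phi> \<longrightarrow>
              (LINT x|hvol. form_inner x (v x) (\<phi> x)) = (LINT x|hvol. f x * codiff \<phi> x))"

definition weak_codiff :: "'n::finite one_form \<Rightarrow> 'n scalar_field \<Rightarrow> bool"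
  where "weak_codiff w h \<longleftrightarrow> L1loc w \<and> L1loc h \<and>
           (\<forall>\<phi>. test_fun \<phi> \<longrightarrow>
              (LINT x|hvol. h x * \<phi> x) = (LINT x|hvol. form_inner x (w x) (ext_d \<phi> x)))"

definition weak_nabla :: "'n::finite one_form \<Rightarrow> 'n two_tensor \<Rightarrow> bool"
  where "weak_nabla u T \<longleftrightarrow> L1loc u \<and> L1loc T \<and>
           (\<forall>\<Phi>. test_tensor \<Phi> \<longrightarrow>
              (LINT x|hvol. tensor_inner x (T x) (\<Phi> x))
                = (LINT x|hvol. form_inner x (u x) (nabla_adj \<Phi> x)))"

definition weak_L :: "'n::finite one_form \<Rightarrow> 'n one_form \<Rightarrow> bool"
  \<comment> \<open>\<open>L_op\<close> is formally self-adjoint.\<close>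
  where "weak_L u v \<longleftrightarrow> L1loc u \<and> L1loc v \<and>
           (\<forall>\<phi>. test_form \<phi> \<longrightarrow>
              (LINT x|hvol. form_inner x (v x) (\<phi> x)) = (LINT x|hvol. form_inner x (u x) (L_op \<phi> x)))"

definition weak_div :: "'n::finite two_tensor \<Rightarrow> 'n vec_field \<Rightarrow> bool"
  \<comment> \<open>\<open>V\<close> is the divergence of the contravariant tensor \<open>S\<close>, contracted in the first index; vector
     fields and contravariant tensors are paired with forms and covariant tensors by the
     metric-free duality pairing.\<close>
  where "weak_div S V \<longleftrightarrow> L1loc S \<and> L1loc V \<and>
           (\<forall>\<phi>. test_form \<phi> \<longrightarrow>
              (LINT x|hvol. (\<Sum>j\<in>UNIV. V x $ j * \<phi> x $ j))
                = - (LINT x|hvol. (\<Sum>i\<in>UNIV. \<Sum>j\<in>UNIV. S x $ i $ j * nabla \<phi> x $ i $ j)))"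


subsection \<open>Lebesgue spaces\<close>

text \<open>
  Elements are representatives, and equality in the spaces is equality almost everywhere. The
  parameter \<open>N\<close> is one of \<open>scalar_norm\<close>, \<open>form_norm\<close>, \<open>tensor_norm\<close>.
\<close>

definition Lq :: "(real ^ 'n::finite \<Rightarrow> 'b::real_normed_vector \<Rightarrow> real) \<Rightarrow> real
    \<Rightarrow> (real ^ 'n \<Rightarrow> 'b) set"
  where "Lq N q = {u. u \<in> borel_measurable hvol \<and> integrable hvol (\<lambda>x. N x (u x) powr q)}"

definition Lq_norm :: "(real ^ 'n::finite \<Rightarrow> 'b::real_normed_vector \<Rightarrow> real) \<Rightarrow> real
    \<Rightarrow> (real ^ 'n \<Rightarrow> 'b) \<Rightarrow> real"
  where "Lq_norm N q u = (LINT x|hvol. N x (u x) powr q) powr (1 / q)"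

definition Lq_dist :: "(real ^ 'n::finite \<Rightarrow> 'b::real_normed_vector \<Rightarrow> real) \<Rightarrow> real
    \<Rightarrow> (real ^ 'n \<Rightarrow> 'b) \<Rightarrow> (real ^ 'n \<Rightarrow> 'b) \<Rightarrow> real"
  where "Lq_dist N q u v = Lq_norm N q (\<lambda>x. u x - v x)"

definition ae_eq :: "(real ^ 'n::finite \<Rightarrow> 'b) \<Rightarrow> (real ^ 'n \<Rightarrow> 'b) \<Rightarrow> bool"
  where "ae_eq u v \<longleftrightarrow> (AE x in hvol. u x = v x)"

definition BC_Lq :: "(real ^ 'n::finite \<Rightarrow> 'b::real_normed_vector \<Rightarrow> real) \<Rightarrow> real \<Rightarrow> real set
    \<Rightarrow> (real \<Rightarrow> real ^ 'n \<Rightarrow> 'b) \<Rightarrow> bool"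
  where "BC_Lq N q I w \<longleftrightarrow> (\<forall>t\<in>I. w t \<in> Lq N q) \<and>
           (\<forall>t\<in>I. ((\<lambda>s. Lq_dist N q (w s) (w t)) \<longlongrightarrow> 0) (at t within I)) \<and>
           (\<exists>C. \<forall>t\<in>I. Lq_norm N q (w t) \<le> C)"

text \<open>
  The Bochner theory for curves with values in \<open>Lq N q\<close>, which is not a type: strong measurability
  is almost everywhere approximability by simple functions.
\<close>

definition Lq_simple_approx :: "(real ^ 'n::finite \<Rightarrow> 'b::real_normed_vector \<Rightarrow> real) \<Rightarrow> real
    \<Rightarrow> real set \<Rightarrow> (real \<Rightarrow> real ^ 'n \<Rightarrow> 'b) \<Rightarrow> (nat \<Rightarrow> real \<Rightarrow> real ^ 'n \<Rightarrow> 'b) \<Rightarrow> bool"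
  where "Lq_simple_approx N q I F S \<longleftrightarrow>
           (\<forall>k. simple_function (lebesgue_on I) (S k) \<and> S k ` I \<subseteq> Lq N q) \<and>
           (AE t in lebesgue_on I. F t \<in> Lq N q \<and> (\<lambda>k. Lq_dist N q (S k t) (F t)) \<longlonglongrightarrow> 0)"

definition Lr_Lq :: "(real ^ 'n::finite \<Rightarrow> 'b::real_normed_vector \<Rightarrow> real) \<Rightarrow> real \<Rightarrow> real
    \<Rightarrow> real set \<Rightarrow> (real \<Rightarrow> real ^ 'n \<Rightarrow> 'b) set"
  where "Lr_Lq N r q I = {F. (\<exists>S. Lq_simple_approx N q I F S) \<and>
           (\<integral>\<^sup>+ t. ennreal (Lq_norm N q (F t) powr r) \<partial>lebesgue_on I) < \<infinity>}"

definition simple_integral_Lq :: "real set \<Rightarrow> (real \<Rightarrow> real ^ 'n::finite \<Rightarrow> 'b::real_normed_vector)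
    \<Rightarrow> (real ^ 'n \<Rightarrow> 'b)"
  where "simple_integral_Lq I S x = (\<Sum>v\<in>S ` I. measure lebesgue {t \<in> I. S t = v} *\<^sub>R v x)"

definition has_Bochner_integral_Lq :: "(real ^ 'n::finite \<Rightarrow> 'b::real_normed_vector \<Rightarrow> real) \<Rightarrow> real
    \<Rightarrow> real set \<Rightarrow> (real \<Rightarrow> real ^ 'n \<Rightarrow> 'b) \<Rightarrow> (real ^ 'n \<Rightarrow> 'b) \<Rightarrow> bool"
  \<comment> \<open>For bounded intervals \<open>I\<close>.\<close>
  where "has_Bochner_integral_Lq N q I F v \<longleftrightarrow> v \<in> Lq N q \<and>
           (\<exists>S. Lq_simple_approx N q I F S \<and>
              (\<lambda>k. \<integral>\<^sup>+ t. ennreal (Lq_dist N q (S k t) (F t)) \<partial>lebesgue_on I) \<longlonglongrightarrow> 0 \<and>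
              (\<lambda>k. Lq_dist N q (simple_integral_Lq I (S k)) v) \<longlonglongrightarrow> 0)"


subsection \<open>The Leray projection and the semigroup\<close>

definition inv_lap_codiff :: "real \<Rightarrow> 'n::finite one_form \<Rightarrow> 'n scalar_field"
  \<comment> \<open>\<open>(-\<Delta>)\<^sup>-\<^sup>1 d\<^sup>* w\<close> for \<open>w\<close> in \<open>L\<^sup>p\<close>: the solution \<open>f\<close> in \<open>L\<^sup>p\<close> of \<open>-\<Delta> f = d\<^sup>* w\<close> in the sense of
     distributions. For \<open>1 < p < \<infinity>\<close> it exists and is unique up to null sets.\<close>
  where "inv_lap_codiff p w = (SOME f. f \<in> Lq scalar_norm p \<and>
           (\<forall>\<phi>. test_fun \<phi> \<longrightarrow>
              (LINT x|hvol. f x * (- hlap \<phi> x)) = (LINT x|hvol. form_inner x (w x) (ext_d \<phi> x))))"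

definition Leray :: "real \<Rightarrow> 'n::finite one_form \<Rightarrow> 'n one_form"
  where "Leray p w x = w x - (SOME v. weak_ext_d (inv_lap_codiff p w) v) x"

definition L_semigroup :: "real \<Rightarrow> (real \<Rightarrow> 'n::finite one_form \<Rightarrow> 'n one_form) \<Rightarrow> bool"
  \<comment> \<open>\<open>S\<close> is a strongly continuous semigroup of bounded linear operators on \<open>L\<^sup>p\<close> one-forms whose
     generator is \<open>L\<close>, with domain the one-forms \<open>f\<close> in \<open>L\<^sup>p\<close> with \<open>L f\<close> in \<open>L\<^sup>p\<close>.\<close>
  where "L_semigroup p S \<longleftrightarrow>
           (\<forall>t\<ge>0. \<forall>f\<in>Lq form_norm p. S t f \<in> Lq form_norm p) \<and>
           (\<forall>t\<ge>0. \<forall>f\<in>Lq form_norm p. \<forall>g\<in>Lq form_norm p. \<forall>c.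
              ae_eq (S t (\<lambda>x. c *\<^sub>R f x + g x)) (\<lambda>x. c *\<^sub>R S t f x + S t g x)) \<and>
           (\<forall>t\<ge>0. \<exists>C. \<forall>f\<in>Lq form_norm p. Lq_norm form_norm p (S t f) \<le> C * Lq_norm form_norm p f) \<and>
           (\<forall>f\<in>Lq form_norm p. ae_eq (S 0 f) f) \<and>
           (\<forall>s\<ge>0. \<forall>t\<ge>0. \<forall>f\<in>Lq form_norm p. ae_eq (S (s + t) f) (S s (S t f))) \<and>
           (\<forall>f\<in>Lq form_norm p. ((\<lambda>t. Lq_dist form_norm p (S t f) f) \<longlongrightarrow> 0) (at_right 0)) \<and>
           (\<forall>f\<in>Lq form_norm p. \<forall>g\<in>Lq form_norm p.
              ((\<lambda>h. Lq_dist form_norm p (\<lambda>x. (1 / h) *\<^sub>R (S h f x - f x)) g) \<longlongrightarrow> 0) (at_right 0)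
                \<longleftrightarrow> weak_L f g)"

definition exp_L :: "real \<Rightarrow> real \<Rightarrow> 'n::finite one_form \<Rightarrow> 'n one_form"
  \<comment> \<open>A semigroup is determined by its generator, so \<open>exp_L p t f\<close> is unique up to null sets.\<close>
  where "exp_L p = (SOME S. L_semigroup p S)"


subsection \<open>Mild solutions\<close>

definition tensor_square :: "'n::finite vec_field \<Rightarrow> 'n two_tensor"
  where "tensor_square X x = (\<chi> i j. X x $ i * X x $ j)"

definition convection :: "'n::finite one_form \<Rightarrow> 'n one_form"
  where "convection u = flat (SOME V. weak_div (tensor_square (sharp u)) V)"

definition time_ival :: "ereal \<Rightarrow> real set"
  where "time_ival T = {t. 0 \<le> t \<and> ereal t < T}"

definition open_time_ival :: "ereal \<Rightarrow> real set"
  where "open_time_ival T = {t. 0 < t \<and> ereal t < T}"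

definition mild_solution :: "'n::finite one_form \<Rightarrow> ereal \<Rightarrow> (real \<Rightarrow> 'n one_form) \<Rightarrow> bool"
  \<comment> \<open>The projection, the semigroup and the time integral are taken in \<open>L\<^sup>n\<close>, \<open>n = CARD('n)\<close>, the space
     of the datum; the operators on different \<open>L\<^sup>p\<close> agree on intersections.\<close>
  where "mild_solution a T u \<longleftrightarrow> (\<forall>t\<in>time_ival T. \<exists>J.
           has_Bochner_integral_Lq form_norm (real CARD('n)) {0<..<t}
             (\<lambda>s. exp_L (real CARD('n)) (t - s) (Leray (real CARD('n)) (convection (u s)))) J \<and>
           ae_eq (u t) (\<lambda>x. exp_L (real CARD('n)) t a x - J x))"

definition weighted :: "real \<Rightarrow> real \<Rightarrow> (real ^ 'n::finite \<Rightarrow> 'b::real_normed_vector)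
    \<Rightarrow> (real \<Rightarrow> real ^ 'n \<Rightarrow> 'b) \<Rightarrow> (real \<Rightarrow> real ^ 'n \<Rightarrow> 'b)"
  \<comment> \<open>\<open>t\<^sup>\<alpha> e\<^sup>t\<^sup>\<beta> v(t)\<close> for \<open>t > 0\<close>, with prescribed value \<open>v0\<close> at \<open>t = 0\<close> (note that \<open>0 powr 0 = 0\<close>).\<close>
  where "weighted \<alpha> \<beta> v0 v t x = (if t = 0 then v0 x else (t powr \<alpha> * exp (t * \<beta>)) *\<^sub>R v t x)"

definition NS_class :: "'n::finite one_form \<Rightarrow> ereal \<Rightarrow> (real \<Rightarrow> 'n one_form) \<Rightarrow> bool"
  where "NS_class a T u \<longleftrightarrow> mild_solution a T u \<and> ae_eq (u 0) a \<and>
           (\<exists>D. (\<forall>t\<in>open_time_ival T. weak_nabla (u t) (D t)) \<and>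
             (\<forall>q. real CARD('n) \<le> q \<longrightarrow>
                (\<exists>\<beta>>0. BC_Lq form_norm q (time_ival T)
                   (weighted (1 / 2 - real CARD('n) / (2 * q)) \<beta>
                      (if q = real CARD('n) then a else (\<lambda>_. 0)) u)) \<and>
                (\<exists>\<beta>>0. BC_Lq tensor_norm q (time_ival T)
                   (weighted (1 - real CARD('n) / (2 * q)) \<beta> (\<lambda>_. 0) D))))"

definition NS_solution :: "'n::finite one_form \<Rightarrow> ereal \<Rightarrow> (real \<Rightarrow> 'n one_form) \<Rightarrow> bool"
  where "NS_solution a T u \<longleftrightarrow> NS_class a T u \<and>
           (\<forall>v. NS_class a T v \<longrightarrow> (\<forall>t\<in>time_ival T. ae_eq (v t) (u t)))"

definition NS_datum :: "'n::finite one_form \<Rightarrow> bool"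
  where "NS_datum a \<longleftrightarrow> a \<in> Lq form_norm (real CARD('n)) \<and> weak_codiff a (\<lambda>_. 0)"

definition global_smallness_const :: "'n::finite itself \<Rightarrow> real \<Rightarrow> bool"
  where "global_smallness_const _ lam \<longleftrightarrow> 0 < lam \<and>
           (\<forall>a::'n one_form. NS_datum a \<and> Lq_norm form_norm (real CARD('n)) a \<le> lam
              \<longrightarrow> (\<exists>u. NS_class a \<infinity> u))"

end

theory Submission
  imports Defs
begin

text \<open>
  The theorem is a consequence of the decay rates that are built into the solution class. For
  \<open>n < q < \<infinity>\<close> put \<open>\<alpha> = 1/2 - n/(2q)\<close>. Boundedness of \<open>t\<^sup>\<alpha> e\<^sup>\<beta>\<^sup>t u(t)\<close> in \<open>L\<^sup>q\<close> for some \<open>\<beta> > 0\<close>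
  says that \<open>\<parallel>u(t)\<parallel>\<^sub>q \<le> C t\<^sup>-\<^sup>\<alpha> e\<^sup>-\<^sup>\<beta>\<^sup>t\<close>. The \<open>r\<close>-th power of this bound is integrable at \<open>t = 0\<close>
  because the hypothesis on \<open>r\<close> is precisely \<open>\<alpha>r < 1\<close>, and it is integrable at infinity because of the
  exponential factor (\<open>decay_imp_Lr_finite\<close>). The spectral gap of hyperbolic space, which is the
  source of that factor, is what makes the case \<open>T = \<infinity>\<close> no harder than a bounded interval.

  Membership in \<open>L\<^sup>r((0,T), L\<^sup>q)\<close> also demands strong measurability. It follows from continuity:
  dividing a continuous curve by the continuous weight leaves it continuous away from \<open>t = 0\<close>
  (\<open>Lq_continuous_scaleR\<close>), and a continuous curve is the pointwise limit of its samples on dyadic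
  grids (\<open>continuous_imp_Lq_simple_approx\<close>).

  For small data there is a global element \<open>v\<close> of the solution class. All defining conditions of the
  class pass to shorter time intervals (\<open>NS_class_mono\<close>), so uniqueness on \<open>[0,T)\<close> identifies \<open>v\<close> with
  \<open>u\<close> there, and the integrability argument applies to \<open>v\<close> with \<open>T = \<infinity>\<close>.
\<close>

section \<open>The pointwise norm of one-forms\<close>

lemma matrix_inv_mat:
  fixes c :: real
  assumes "c \<noteq> 0"
  shows "matrix_inv (mat c :: real ^ 'n::finite ^ 'n) = mat (1 / c)"
proof -
  have mult: "(mat a :: real ^ 'n ^ 'n) ** mat b = mat (a * b)" for a b :: real
    by (simp add: matrix_matrix_mult_def mat_def vec_eq_iff mult_delta_left)
  have "invertible (mat c :: real ^ 'n ^ 'n)"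
    unfolding invertible_def using assms by (auto intro!: exI[of _ "mat (1 / c)"] simp: mult)
  then have inv: "matrix_inv (mat c) ** mat c = (mat 1 :: real ^ 'n ^ 'n)"
    unfolding matrix_inv_def invertible_def by (rule someI2_ex) simp
  have "matrix_inv (mat c) = matrix_inv (mat c) ** (mat c ** mat (1 / c) :: real ^ 'n ^ 'n)"
    using assms by (simp add: mult)
  also have "\<dots> = mat (1 / c)"
    by (simp add: matrix_mul_assoc inv)
  finally show ?thesis .
qed

text \<open>
  The metric is conformal to the Euclidean one, so its norm on covectors is the Euclidean norm divided
  by the conformal factor \<open>2 / (1 - |x|\<^sup>2)\<close>. This reduces the norm axioms and measurability of
  \<open>form_norm\<close> to the Euclidean norm.
\<close>

lemma form_norm_eq:
  fixes x :: "real ^ 'n::finite"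
  assumes "x \<in> hspace"
  shows "form_norm x v = (1 - (norm x)\<^sup>2) / 2 * norm v"
proof -
  have pos: "1 - (norm x)\<^sup>2 > 0"
    using assms by (simp add: power_less_one_iff)
  then have "ginv x = mat ((1 - (norm x)\<^sup>2)\<^sup>2 / 4)"
    by (simp add: ginv_def gmat_def matrix_inv_mat)
  then have "form_inner x v v = (\<Sum>i\<in>UNIV. (1 - (norm x)\<^sup>2)\<^sup>2 / 4 * v $ i * v $ i)"
    by (simp add: form_inner_def mat_def mult_delta_left)
  also have "\<dots> = (1 - (norm x)\<^sup>2)\<^sup>2 / 4 * (v \<bullet> v)"
    by (simp only: inner_vec_def inner_real_def sum_distrib_left mult.assoc)
  also have "\<dots> = ((1 - (norm x)\<^sup>2) / 2 * norm v)\<^sup>2"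
    by (simp add: power_mult_distrib power_divide flip: power2_norm_eq_inner)
  finally show ?thesis
    using pos by (simp add: form_norm_def)
qed

lemma space_hvol: "space (hvol :: (real ^ 'n::finite) measure) = hspace"
  by (simp add: hvol_def space_restrict_space)

lemma borel_measurable_hvol_I: "f \<in> borel_measurable borel \<Longrightarrow> f \<in> borel_measurable hvol"
  by (simp add: hvol_def measurable_restrict_space1)

lemma form_norm_nonneg:
  assumes "x \<in> hspace" shows "0 \<le> form_norm x v"
proof -
  have "(norm x)\<^sup>2 \<le> 1" using assms by (simp add: power_le_one)
  then show ?thesis using assms by (simp add: form_norm_eq)
qed

lemma form_norm_scaleR: "x \<in> hspace \<Longrightarrow> form_norm x (c *\<^sub>R v) = \<bar>c\<bar> * form_norm x v"
  by (simp add: form_norm_eq)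

lemma form_norm_triangle:
  assumes "x \<in> hspace" shows "form_norm x (v + w) \<le> form_norm x v + form_norm x w"
proof -
  have "(norm x)\<^sup>2 \<le> 1" using assms by (simp add: power_le_one)
  then show ?thesis
    using assms norm_triangle_ineq[of v w]
    by (simp add: form_norm_eq flip: distrib_left) (simp add: mult_left_mono)
qed

lemma borel_measurable_form_norm:
  assumes "u \<in> borel_measurable hvol"
  shows "(\<lambda>x. form_norm x (u x)) \<in> borel_measurable hvol"
proof -
  have "(\<lambda>x. (1 - (norm x)\<^sup>2) / 2 :: real) \<in> borel_measurable hvol"
    by (intro borel_measurable_hvol_I) measurable
  then have "(\<lambda>x. (1 - (norm x)\<^sup>2) / 2 * norm (u x)) \<in> borel_measurable hvol"
    using assms by (intro borel_measurable_times borel_measurable_norm) auto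
  then show ?thesis
    by (rule measurable_cong[THEN iffD1, rotated]) (simp add: space_hvol form_norm_eq)
qed

section \<open>Lebesgue spaces of one-forms\<close>

lemma zero_in_Lq: "(\<lambda>_. 0 :: real ^ 'n::finite) \<in> Lq form_norm q"
proof -
  have "integrable hvol (\<lambda>x :: real ^ 'n. form_norm x 0 powr q) \<longleftrightarrow>
      integrable hvol (\<lambda>x :: real ^ 'n. 0 :: real)"
    by (rule Bochner_Integration.integrable_cong) (simp_all add: space_hvol form_norm_eq)
  then show ?thesis by (simp add: Lq_def)
qed

lemma scaleR_in_Lq:
  assumes "f \<in> Lq form_norm q"
  shows "(\<lambda>x. c *\<^sub>R f x) \<in> Lq form_norm q"
proof -
  have "integrable hvol (\<lambda>x. form_norm x (c *\<^sub>R f x) powr q) \<longleftrightarrow>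
        integrable hvol (\<lambda>x. \<bar>c\<bar> powr q * form_norm x (f x) powr q)"
    by (rule Bochner_Integration.integrable_cong)
      (simp_all add: space_hvol form_norm_scaleR form_norm_nonneg powr_mult)
  then show ?thesis using assms by (auto simp: Lq_def)
qed

lemma Lq_norm_nonneg: "0 \<le> Lq_norm N q f"
  by (simp add: Lq_norm_def)

lemma Lq_norm_scaleR:
  assumes "q \<noteq> 0"
  shows "Lq_norm form_norm q (\<lambda>x. c *\<^sub>R f x) = \<bar>c\<bar> * Lq_norm form_norm q f"
proof -
  have "(LINT x|hvol. form_norm x (c *\<^sub>R f x) powr q) =
        (LINT x|hvol. \<bar>c\<bar> powr q * form_norm x (f x) powr q)"
    by (rule Bochner_Integration.integral_cong)
      (simp_all add: space_hvol form_norm_scaleR form_norm_nonneg powr_mult)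
  then show ?thesis
    using assms by (simp add: Lq_norm_def powr_mult powr_powr)
qed

lemma powr_add_le:
  fixes a b q :: real
  assumes "0 \<le> a" "0 \<le> b" "0 \<le> q"
  shows "(a + b) powr q \<le> 2 powr q * (a powr q + b powr q)"
proof -
  have "(a + b) powr q \<le> (2 * max a b) powr q"
    using assms by (intro powr_mono2) auto
  also have "\<dots> = 2 powr q * max a b powr q"
    using assms by (simp add: powr_mult)
  also have "\<dots> \<le> 2 powr q * (a powr q + b powr q)"
    by (intro mult_left_mono) (auto simp: max_def)
  finally show ?thesis .
qed

text \<open>
  A quasi-triangle inequality takes the place of Minkowski's inequality: only convergence to zero and
  membership are at stake, and for these a constant does no harm. Of the constant \<open>4\<close>, one factor \<open>2\<close>
  is the \<open>q\<close>-th root of the constant in \<open>powr_add_le\<close>, and the other bounds the quasi-additivity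
  constant \<open>2 powr (1 / q)\<close> of the root itself.
\<close>

lemma
  assumes "1 \<le> q" and f: "f \<in> Lq form_norm q" and g: "g \<in> Lq form_norm q"
  shows add_in_Lq: "(\<lambda>x. f x + g x) \<in> Lq form_norm q"
    and Lq_norm_add_le:
      "Lq_norm form_norm q (\<lambda>x. f x + g x) \<le> 4 * (Lq_norm form_norm q f + Lq_norm form_norm q g)"
proof -
  let ?F = "\<lambda>x. form_norm x (f x) powr q" and ?G = "\<lambda>x. form_norm x (g x) powr q"
  let ?H = "\<lambda>x. form_norm x (f x + g x) powr q"
  have bound: "?H x \<le> 2 powr q * (?F x + ?G x)" if "x \<in> hspace" for x
  proof -
    have "?H x \<le> (form_norm x (f x) + form_norm x (g x)) powr q"
      using that \<open>1 \<le> q\<close> by (intro powr_mono2) (auto simp: form_norm_nonneg form_norm_triangle)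
    also have "\<dots> \<le> 2 powr q * (?F x + ?G x)"
      using that \<open>1 \<le> q\<close> by (intro powr_add_le) (auto simp: form_norm_nonneg)
    finally show ?thesis .
  qed
  have dom: "integrable hvol (\<lambda>x. 2 powr q * (?F x + ?G x))"
    using f g by (auto simp: Lq_def)
  have meas: "(\<lambda>x. f x + g x) \<in> borel_measurable hvol"
    using f g by (auto simp: Lq_def)
  have "integrable hvol ?H"
    by (rule Bochner_Integration.integrable_bound[OF dom])
      (use bound in \<open>auto simp: space_hvol intro!: AE_I2 powr_real_measurable
          borel_measurable_form_norm[OF meas] intro: order_trans[OF _ abs_ge_self]\<close>)
  then show "(\<lambda>x. f x + g x) \<in> Lq form_norm q"
    using meas by (simp add: Lq_def)
  let ?A = "LINT x|hvol. ?F x" and ?B = "LINT x|hvol. ?G x"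
  have nonneg: "0 \<le> ?A" "0 \<le> ?B" by (auto intro: integral_nonneg_AE)
  have "(LINT x|hvol. ?H x) \<le> (LINT x|hvol. 2 powr q * (?F x + ?G x))"
    using \<open>integrable hvol ?H\<close> dom bound by (intro integral_mono) (auto simp: space_hvol)
  also have "\<dots> = 2 powr q * (?A + ?B)"
    using f g by (auto simp: Lq_def)
  finally have "(LINT x|hvol. ?H x) powr (1 / q) \<le> (2 powr q * (?A + ?B)) powr (1 / q)"
    using \<open>1 \<le> q\<close> by (intro powr_mono2) (auto intro: integral_nonneg_AE)
  also have "\<dots> = 2 * (?A + ?B) powr (1 / q)"
    using \<open>1 \<le> q\<close> nonneg by (simp add: powr_mult powr_powr)
  also have "(?A + ?B) powr (1 / q) \<le> 2 powr (1 / q) * (?A powr (1 / q) + ?B powr (1 / q))"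
    using \<open>1 \<le> q\<close> nonneg by (intro powr_add_le) auto
  also have "2 powr (1 / q) * (?A powr (1 / q) + ?B powr (1 / q))
      \<le> 2 * (?A powr (1 / q) + ?B powr (1 / q))"
    using \<open>1 \<le> q\<close> powr_mono[of "1 / q" 1 "2 :: real"] by (intro mult_right_mono) auto
  finally show "Lq_norm form_norm q (\<lambda>x. f x + g x)
      \<le> 4 * (Lq_norm form_norm q f + Lq_norm form_norm q g)"
    by (simp add: Lq_norm_def)
qed

lemma diff_in_Lq:
  assumes "1 \<le> q" "f \<in> Lq form_norm q" "g \<in> Lq form_norm q"
  shows "(\<lambda>x. f x - g x) \<in> Lq form_norm q"
  using add_in_Lq[OF assms(1,2) scaleR_in_Lq[OF assms(3), of "-1"]] by simp

section \<open>Curves in Lebesgue spaces\<close>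

lemma Lq_dist_self: "q \<noteq> 0 \<Longrightarrow> Lq_dist form_norm q f f = 0"
  using Lq_norm_scaleR[of q 0 f] by (simp add: Lq_dist_def)

text \<open>
  The bound comes from splitting
  \<open>c(s) w(s) - c(t) w(t) = c(s) (w(s) - w(t)) + (c(s) - c(t)) w(t)\<close>. With \<open>c\<close> the reciprocal of the
  time weight, it transfers continuity from the weighted curve to the curve itself.
\<close>

lemma Lq_continuous_scaleR:
  fixes w :: "real \<Rightarrow> real ^ 'n::finite \<Rightarrow> real ^ 'n"
  assumes "1 \<le> q" and w: "\<And>s. s \<in> I \<Longrightarrow> w s \<in> Lq form_norm q" and "t \<in> I"
    and lim: "((\<lambda>s. Lq_dist form_norm q (w s) (w t)) \<longlongrightarrow> 0) (at t within I)"
    and c: "(c \<longlongrightarrow> c t) (at t within I)"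
  shows "((\<lambda>s. Lq_dist form_norm q (\<lambda>x. c s *\<^sub>R w s x) (\<lambda>x. c t *\<^sub>R w t x)) \<longlongrightarrow> 0)
    (at t within I)"
proof (rule tendsto_sandwich[OF _ _ tendsto_const])
  let ?b = "\<lambda>s. 4 * (\<bar>c s\<bar> * Lq_dist form_norm q (w s) (w t)
      + \<bar>c s - c t\<bar> * Lq_norm form_norm q (w t))"
  show "\<forall>\<^sub>F s in at t within I.
      0 \<le> Lq_dist form_norm q (\<lambda>x. c s *\<^sub>R w s x) (\<lambda>x. c t *\<^sub>R w t x)"
    by (simp add: Lq_dist_def Lq_norm_nonneg)
  have "Lq_dist form_norm q (\<lambda>x. c s *\<^sub>R w s x) (\<lambda>x. c t *\<^sub>R w t x) \<le> ?b s" if "s \<in> I" for s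
  proof -
    have "(\<lambda>x. c s *\<^sub>R w s x - c t *\<^sub>R w t x) =
        (\<lambda>x. c s *\<^sub>R (w s x - w t x) + (c s - c t) *\<^sub>R w t x)"
      by (simp add: algebra_simps)
    then show ?thesis
      using Lq_norm_add_le[OF \<open>1 \<le> q\<close>
          scaleR_in_Lq[OF diff_in_Lq[OF \<open>1 \<le> q\<close> w[OF that] w[OF \<open>t \<in> I\<close>]], of "c s"]
          scaleR_in_Lq[OF w[OF \<open>t \<in> I\<close>], of "c s - c t"]] \<open>1 \<le> q\<close>
      by (simp add: Lq_dist_def Lq_norm_scaleR)
  qed
  then show "\<forall>\<^sub>F s in at t within I.
      Lq_dist form_norm q (\<lambda>x. c s *\<^sub>R w s x) (\<lambda>x. c t *\<^sub>R w t x) \<le> ?b s"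
    by (simp add: eventually_at_filter)
  have "(?b \<longlongrightarrow> 4 * (\<bar>c t\<bar> * 0 + \<bar>c t - c t\<bar> * Lq_norm form_norm q (w t))) (at t within I)"
    by (intro tendsto_intros lim c)
  then show "(?b \<longlongrightarrow> 0) (at t within I)" by simp
qed

lemma dyadic_floor_tendsto:
  fixes t :: real
  shows "(\<lambda>k. real_of_int \<lfloor>t * 2 ^ k\<rfloor> / 2 ^ k) \<longlonglongrightarrow> t"
proof (rule tendsto_sandwich)
  show "\<forall>\<^sub>F k in sequentially. t - (1 / 2) ^ k \<le> real_of_int \<lfloor>t * 2 ^ k\<rfloor> / 2 ^ k"
  proof (rule always_eventually, rule allI)
    fix k
    have "t * 2 ^ k - 1 \<le> real_of_int \<lfloor>t * 2 ^ k\<rfloor>" by linarith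
    then have "(t * 2 ^ k - 1) / 2 ^ k \<le> real_of_int \<lfloor>t * 2 ^ k\<rfloor> / 2 ^ k"
      by (intro divide_right_mono) auto
    then show "t - (1 / 2) ^ k \<le> real_of_int \<lfloor>t * 2 ^ k\<rfloor> / 2 ^ k"
      by (simp add: diff_divide_distrib power_one_over)
  qed
  show "\<forall>\<^sub>F k in sequentially. real_of_int \<lfloor>t * 2 ^ k\<rfloor> / 2 ^ k \<le> t"
    by (simp add: divide_le_eq)
  have "(\<lambda>k. t - (1 / 2 :: real) ^ k) \<longlonglongrightarrow> t - 0"
    by (intro tendsto_intros LIMSEQ_power_zero) auto
  then show "(\<lambda>k. t - (1 / 2 :: real) ^ k) \<longlonglongrightarrow> t" by simp
qed simp

text \<open>
  The approximants sample \<open>F\<close> at \<open>t\<close> rounded down to the dyadic grid of level \<open>k\<close>. Rounding down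
  keeps the sample point below \<open>T\<close>. The zero field replaces the sample where the dyadic point is the excluded
  time \<open>0\<close>, and also for \<open>t \<ge> k\<close>, which leaves only finitely many values when \<open>T = \<infinity>\<close>; every fixed \<open>t\<close>
  escapes both exceptions once \<open>k\<close> is large.
\<close>

lemma continuous_imp_Lq_simple_approx:
  fixes F :: "real \<Rightarrow> real ^ 'n::finite \<Rightarrow> real ^ 'n" and T :: ereal
  defines "I \<equiv> open_time_ival T"
  assumes "q \<noteq> 0" and F: "\<And>t. t \<in> I \<Longrightarrow> F t \<in> Lq form_norm q"
    and cont: "\<And>t. t \<in> I \<Longrightarrow> ((\<lambda>s. Lq_dist form_norm q (F s) (F t)) \<longlongrightarrow> 0) (at t within I)"
  shows "\<exists>S. Lq_simple_approx form_norm q I F S"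
proof -
  \<comment> \<open>Index of the sample point; the index \<open>0\<close> stands for the zero field.\<close>
  define j :: "nat \<Rightarrow> real \<Rightarrow> int" where "j k t = (if t < real k then \<lfloor>t * 2 ^ k\<rfloor> else 0)" for k t
  define S where "S k = (\<lambda>m. if m = 0 then (\<lambda>_. 0) else F (real_of_int m / 2 ^ k)) \<circ> j k" for k
  have j_nonneg: "0 \<le> j k t" if "t \<in> I" for k t
    using that by (auto simp: j_def I_def open_time_ival_def)
  have grid: "real_of_int (j k t) / 2 ^ k \<in> I" if "t \<in> I" "j k t \<noteq> 0" for k t
  proof -
    have "real_of_int (j k t) / 2 ^ k \<le> t"
      using that(2) by (simp add: j_def divide_le_eq split: if_splits)
    then have "ereal (real_of_int (j k t) / 2 ^ k) \<le> ereal t" by simp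
    also have "\<dots> < T" using that(1) by (simp add: I_def open_time_ival_def)
    finally show ?thesis
      using that j_nonneg[OF that(1), of k] by (auto simp: I_def open_time_ival_def)
  qed
  have simple: "simple_function (lebesgue_on I) (S k)" for k
    unfolding S_def
  proof (rule simple_function_compose)
    have "j k ` I \<subseteq> {0..\<lfloor>real k * 2 ^ k\<rfloor>}"
    proof (rule image_subsetI)
      fix t assume "t \<in> I"
      then show "j k t \<in> {0..\<lfloor>real k * 2 ^ k\<rfloor>}"
        using j_nonneg[of t k] by (auto simp: j_def intro!: floor_mono)
    qed
    then have "finite (j k ` I)" using finite_subset by blast
    moreover have "j k \<in> measurable borel (count_space UNIV)"
      unfolding j_def by measurable
    then have "j k \<in> measurable (lebesgue_on I) (count_space UNIV)"
      by (intro measurable_restrict_space1 measurable_completion) simp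
    ultimately show "simple_function (lebesgue_on I) (j k)"
      by (simp add: simple_function_eq_measurable)
  qed
  have "S k ` I \<subseteq> Lq form_norm q" for k
    using F grid by (auto simp: S_def zero_in_Lq)
  moreover have "(\<lambda>k. Lq_dist form_norm q (S k t) (F t)) \<longlonglongrightarrow> 0" if t: "t \<in> I" for t
  proof -
    have "0 < t" using t by (simp add: I_def open_time_ival_def)
    have "\<forall>\<^sub>F k in sequentially. j k t = \<lfloor>t * 2 ^ k\<rfloor>"
      using eventually_gt_at_top[of "nat \<lceil>t\<rceil>"]
      by eventually_elim (simp add: j_def, linarith)
    then have "(\<lambda>k. real_of_int (j k t) / 2 ^ k) \<longlonglongrightarrow> t"
      by (rule Lim_transform_eventually[OF dyadic_floor_tendsto eventually_mono]) simp
    moreover from order_tendstoD(1)[OF this \<open>0 < t\<close>]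
    have nz: "\<forall>\<^sub>F k in sequentially. j k t \<noteq> 0"
      by eventually_elim auto
    ultimately have lim: "filterlim (\<lambda>k. real_of_int (j k t) / 2 ^ k)
        (inf (nhds t) (principal I)) sequentially"
      unfolding filterlim_inf filterlim_principal
      by (auto elim!: eventually_mono intro: grid[OF t])
    \<comment> \<open>A sample point may coincide with \<open>t\<close>, so the limit is needed on unpunctured neighbourhoods.\<close>
    have "((\<lambda>s. Lq_dist form_norm q (F s) (F t)) \<longlongrightarrow> 0) (inf (nhds t) (principal I))"
      using cont[OF t] Lq_dist_self[OF \<open>q \<noteq> 0\<close>, of "F t"]
      unfolding at_within_def tendsto_def eventually_inf_principal eventually_nhds
      by (smt (verit) Diff_iff empty_iff insert_iff)
    from filterlim_compose[OF this lim]
    show ?thesis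
      by (rule Lim_transform_eventually) (use nz in \<open>eventually_elim, simp add: S_def\<close>)
  qed
  ultimately show ?thesis
    using F simple unfolding Lq_simple_approx_def
    by (intro exI[of _ S]) (auto intro!: AE_I2)
qed

section \<open>Integrability in time\<close>

text \<open>This is the convergence of Euler's integral for the Gamma function at \<open>1 - a\<close>, rescaled by \<open>b\<close>.\<close>

lemma nn_integral_powr_exp_finite:
  fixes a b :: real
  assumes "a < 1" "0 < b"
  shows "(\<integral>\<^sup>+ t. ennreal (t powr (- a) * exp (- (b * t))) \<partial>lebesgue_on {0<..}) < \<infinity>"
proof -
  have "(\<lambda>t. complex_of_real t powr (complex_of_real (1 - a) - 1) / of_real (exp (b * t)))
      absolutely_integrable_on {0<..}"
    using assms by (intro absolutely_integrable_Gamma_integral) auto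
  then have "integrable (lebesgue_on {0<..})
      (\<lambda>t. complex_of_real t powr (complex_of_real (1 - a) - 1) / of_real (exp (b * t)))"
    by (simp add: absolutely_integrable_imp_integrable)
  then have "(\<integral>\<^sup>+ t. ennreal (norm (complex_of_real t powr (complex_of_real (1 - a) - 1)
      / of_real (exp (b * t)))) \<partial>lebesgue_on {0<..}) < \<infinity>"
    by (simp add: integrable_iff_bounded)
  also have "(\<integral>\<^sup>+ t. ennreal (norm (complex_of_real t powr (complex_of_real (1 - a) - 1)
      / of_real (exp (b * t)))) \<partial>lebesgue_on {0<..})
    = (\<integral>\<^sup>+ t. ennreal (t powr (- a) * exp (- (b * t))) \<partial>lebesgue_on {0<..})"
    by (rule nn_integral_cong)
      (auto simp: norm_divide norm_powr_real_powr exp_minus field_simps)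
  finally show ?thesis .
qed

lemma sets_lebesgue_open_time_ival: "open_time_ival T \<in> sets lebesgue"
proof -
  have "open_time_ival T \<in> sets borel"
    unfolding open_time_ival_def by measurable
  then show ?thesis by simp
qed

lemma nn_integral_lebesgue_on_mono_set:
  fixes f :: "real \<Rightarrow> ennreal"
  assumes "A \<subseteq> B" "A \<in> sets lebesgue" "B \<in> sets lebesgue"
  shows "(\<integral>\<^sup>+ t. f t \<partial>lebesgue_on A) \<le> (\<integral>\<^sup>+ t. f t \<partial>lebesgue_on B)"
proof -
  have "(\<integral>\<^sup>+ t. f t * indicator A t \<partial>lebesgue) \<le> (\<integral>\<^sup>+ t. f t * indicator B t \<partial>lebesgue)"
    using assms by (intro nn_integral_mono) (auto simp: indicator_def)
  then show ?thesis
    using assms by (simp add: nn_integral_restrict_space)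
qed

text \<open>
  The \<open>r\<close>-th power of the bound is a Gamma integrand with exponent \<open>- \<alpha> r > - 1\<close>, so its integral is
  finite even over all of \<open>(0,\<infinity>)\<close>.
\<close>

lemma decay_imp_Lr_finite:
  assumes "1 \<le> r" "\<alpha> * r < 1" "0 < \<beta>"
    and bound: "\<And>t. t \<in> open_time_ival T \<Longrightarrow> h t \<le> C * (t powr (- \<alpha>) * exp (- (\<beta> * t)))"
    and nonneg: "\<And>t. 0 \<le> h t"
  shows "(\<integral>\<^sup>+ t. ennreal (h t powr r) \<partial>lebesgue_on (open_time_ival T)) < \<infinity>"
proof -
  define K where "K = \<bar>C\<bar> powr r"
  have "ennreal (h t powr r) \<le> ennreal K * ennreal (t powr (- (\<alpha> * r)) * exp (- (\<beta> * r * t)))"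
    if t: "t \<in> open_time_ival T" for t
  proof -
    have "h t \<le> \<bar>C\<bar> * (t powr (- \<alpha>) * exp (- (\<beta> * t)))"
      using bound[OF t] by (rule order_trans) (intro mult_right_mono, auto)
    then have "h t powr r \<le> (\<bar>C\<bar> * (t powr (- \<alpha>) * exp (- (\<beta> * t)))) powr r"
      using nonneg \<open>1 \<le> r\<close> by (intro powr_mono2) auto
    also have "\<dots> = K * (t powr (- (\<alpha> * r)) * exp (- (\<beta> * r * t)))"
      by (simp add: K_def powr_mult powr_powr exp_powr_real mult.commute mult.left_commute)
    finally show ?thesis
      by (simp add: K_def ennreal_leI flip: ennreal_mult')
  qed
  then have "(\<integral>\<^sup>+ t. ennreal (h t powr r) \<partial>lebesgue_on (open_time_ival T))
    \<le> (\<integral>\<^sup>+ t. ennreal K * ennreal (t powr (- (\<alpha> * r)) * exp (- (\<beta> * r * t)))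
        \<partial>lebesgue_on (open_time_ival T))"
    by (intro nn_integral_mono) simp
  also have "\<dots> \<le> (\<integral>\<^sup>+ t. ennreal K * ennreal (t powr (- (\<alpha> * r)) * exp (- (\<beta> * r * t)))
        \<partial>lebesgue_on {0<..})"
    by (intro nn_integral_lebesgue_on_mono_set sets_lebesgue_open_time_ival)
      (auto simp: open_time_ival_def)
  also have "\<dots> = ennreal K * (\<integral>\<^sup>+ t. ennreal (t powr (- (\<alpha> * r)) * exp (- (\<beta> * r * t)))
        \<partial>lebesgue_on {0<..})"
    by (intro nn_integral_cmult measurable_restrict_space1 measurable_completion) measurable
  also have "\<dots> < \<infinity>"
    using nn_integral_powr_exp_finite[of "\<alpha> * r" "\<beta> * r"] assms(1-3)
    by (simp add: ennreal_mult_less_top)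
  finally show ?thesis .
qed

section \<open>Space-time integrability of solutions\<close>

lemma weighted_BC_imp_Lr_Lq:
  fixes u :: "real \<Rightarrow> 'n::finite one_form"
  assumes "1 \<le> q" "1 \<le> r" "\<alpha> * r < 1" "0 < \<beta>"
    and BC: "BC_Lq form_norm q (time_ival T) (weighted \<alpha> \<beta> v0 u)"
  shows "u \<in> Lr_Lq form_norm r q (open_time_ival T)"
proof -
  let ?I = "open_time_ival T"
  let ?w = "weighted \<alpha> \<beta> v0 u"
  \<comment> \<open>The reciprocal of the weight, which serves both as continuous multiplier and as decay rate.\<close>
  define c where "c s = s powr (- \<alpha>) * exp (- (\<beta> * s))" for s :: real
  have sub: "?I \<subseteq> time_ival T" by (auto simp: open_time_ival_def time_ival_def)
  have pos: "0 < s" if "s \<in> ?I" for s using that by (simp add: open_time_ival_def)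
  have u_eq: "u s = (\<lambda>x. c s *\<^sub>R ?w s x)" if "s \<in> ?I" for s
  proof -
    have "c s * (s powr \<alpha> * exp (s * \<beta>)) = 1"
      using pos[OF that] by (simp add: c_def powr_minus exp_minus field_simps)
    then show ?thesis using pos[OF that] by (simp add: weighted_def)
  qed
  have w: "?w s \<in> Lq form_norm q" if "s \<in> ?I" for s
    using BC sub that by (auto simp: BC_Lq_def)
  have u: "u s \<in> Lq form_norm q" if "s \<in> ?I" for s
    using scaleR_in_Lq[OF w[OF that], of "c s"] u_eq[OF that] by simp
  have cont: "((\<lambda>s. Lq_dist form_norm q (u s) (u t)) \<longlongrightarrow> 0) (at t within ?I)" if t: "t \<in> ?I" for t
  proof -
    have "((\<lambda>s. Lq_dist form_norm q (?w s) (?w t)) \<longlongrightarrow> 0) (at t within ?I)"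
      using BC sub t by (auto simp: BC_Lq_def intro: tendsto_within_subset)
    moreover have "(c \<longlongrightarrow> c t) (at t within ?I)"
      unfolding c_def using pos[OF t] by (intro tendsto_intros) auto
    ultimately have "((\<lambda>s. Lq_dist form_norm q (\<lambda>x. c s *\<^sub>R ?w s x) (\<lambda>x. c t *\<^sub>R ?w t x)) \<longlongrightarrow> 0)
        (at t within ?I)"
      using w t \<open>1 \<le> q\<close> by (intro Lq_continuous_scaleR)
    then show ?thesis
      by (rule Lim_transform_eventually)
        (use u_eq t in \<open>simp add: eventually_at_filter flip: u_eq\<close>)
  qed
  obtain C where "\<forall>s\<in>time_ival T. Lq_norm form_norm q (?w s) \<le> C"
    using BC by (auto simp: BC_Lq_def)
  then have C: "Lq_norm form_norm q (?w s) \<le> C" if "s \<in> ?I" for s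
    using sub that by blast
  have "Lq_norm form_norm q (u s) \<le> C * c s" if "s \<in> ?I" for s
  proof -
    have "0 \<le> c s" by (simp add: c_def)
    have "Lq_norm form_norm q (u s) = c s * Lq_norm form_norm q (?w s)"
      using u_eq[OF that] Lq_norm_scaleR[of q "c s" "?w s"] \<open>1 \<le> q\<close> \<open>0 \<le> c s\<close> by simp
    then show ?thesis
      using mult_left_mono[OF C[OF that] \<open>0 \<le> c s\<close>] by (simp add: mult.commute)
  qed
  then have "(\<integral>\<^sup>+ t. ennreal (Lq_norm form_norm q (u t) powr r) \<partial>lebesgue_on ?I) < \<infinity>"
    unfolding c_def using assms(2-4) by (intro decay_imp_Lr_finite) (auto simp: Lq_norm_nonneg)
  moreover have "\<exists>S. Lq_simple_approx form_norm q ?I u S"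
    using \<open>1 \<le> q\<close> u cont by (intro continuous_imp_Lq_simple_approx) auto
  ultimately show ?thesis by (simp add: Lr_Lq_def)
qed

lemma NS_class_imp_Lr_Lq:
  fixes a :: "'n::finite one_form"
  assumes "NS_class a T u" "1 \<le> r" "real CARD('n) < q"
    and "1 / 2 - real CARD('n) / (2 * q) < 1 / r"
  shows "u \<in> Lr_Lq form_norm r q (open_time_ival T)"
proof -
  have "1 \<le> real CARD('n)" by (simp add: Suc_leI)
  obtain \<beta> v0 where "0 < \<beta>"
    "BC_Lq form_norm q (time_ival T) (weighted (1 / 2 - real CARD('n) / (2 * q)) \<beta> v0 u)"
    using assms(1,3) unfolding NS_class_def by (meson less_imp_le)
  moreover have "1 \<le> q" using assms(3) \<open>1 \<le> real CARD('n)\<close> by linarith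
  ultimately show ?thesis
    using assms(2,4) by (intro weighted_BC_imp_Lr_Lq) (auto simp: pos_less_divide_eq)
qed

lemma BC_Lq_subset:
  assumes "BC_Lq N q J w" "I \<subseteq> J"
  shows "BC_Lq N q I w"
  using assms unfolding BC_Lq_def by (meson subsetD tendsto_within_subset)

text \<open>
  Every condition of the class is a statement at single times, a limit within the time interval or a
  bound uniform over it, and the mild equation at time \<open>t\<close> involves only earlier times. Hence all of
  them survive restriction; the rates \<open>\<beta>\<close> and the weak derivative \<open>D\<close> need no change.
\<close>

lemma NS_class_mono:
  assumes "NS_class a T' v" "T \<le> T'"
  shows "NS_class a T v"
proof -
  have "time_ival T \<subseteq> time_ival T'" "open_time_ival T \<subseteq> open_time_ival T'"
    using \<open>T \<le> T'\<close> by (auto simp: time_ival_def open_time_ival_def intro: less_le_trans)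
  then show ?thesis
    using assms(1) BC_Lq_subset unfolding NS_class_def mild_solution_def
    by (smt (verit, best) subsetD)
qed

theorem theorem1p5:
  fixes a :: "'n::finite one_form" and u :: "real \<Rightarrow> 'n one_form" and T :: ereal
  assumes "2 \<le> CARD('n)"
    and "NS_datum a"
    and "0 < T"
    and "NS_solution a T u"
  shows "(\<forall>r q. 1 \<le> r \<and> real CARD('n) < q \<and> 1 / 2 - real CARD('n) / (2 * q) < 1 / r
            \<longrightarrow> u \<in> Lr_Lq form_norm r q (open_time_ival T)) \<and>
         (\<forall>lam. global_smallness_const TYPE('n) lam \<and> Lq_norm form_norm (real CARD('n)) a \<le> lam \<longrightarrow>
            (\<exists>v. NS_class a \<infinity> v \<and> (\<forall>t\<in>time_ival T. ae_eq (v t) (u t)) \<and>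
               (\<forall>r q. 1 \<le> r \<and> real CARD('n) < q \<and> 1 / 2 - real CARD('n) / (2 * q) < 1 / r
                  \<longrightarrow> v \<in> Lr_Lq form_norm r q (open_time_ival \<infinity>))))"
proof (intro conjI allI impI)
  fix r q
  assume "1 \<le> r \<and> real CARD('n) < q \<and> 1 / 2 - real CARD('n) / (2 * q) < 1 / r"
  then show "u \<in> Lr_Lq form_norm r q (open_time_ival T)"
    using assms(4) NS_class_imp_Lr_Lq unfolding NS_solution_def by blast
next
  fix lam
  assume "global_smallness_const TYPE('n) lam \<and> Lq_norm form_norm (real CARD('n)) a \<le> lam"
  then obtain v where v: "NS_class a \<infinity> v"
    using assms(2) unfolding global_smallness_const_def by blast
  then have "\<forall>t\<in>time_ival T. ae_eq (v t) (u t)"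
    using assms(4) NS_class_mono[OF v, of T] unfolding NS_solution_def by simp
  with v show "\<exists>v. NS_class a \<infinity> v \<and> (\<forall>t\<in>time_ival T. ae_eq (v t) (u t)) \<and>
      (\<forall>r q. 1 \<le> r \<and> real CARD('n) < q \<and> 1 / 2 - real CARD('n) / (2 * q) < 1 / r
         \<longrightarrow> v \<in> Lr_Lq form_norm r q (open_time_ival \<infinity>))"
    using NS_class_imp_Lr_Lq by blast
qed

end
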